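(* Let $n \ge 3$ be an integer and let $\mathbf{u}, \mathbf{v} \in \mathbb{R}^n$ be $0$-mean, unit-length vectors with Pearson product-moment correlation $\rho(\mathbf{u},\mathbf{v}) = r$. Let $q \in [-1,1]$, and let $\mathcal{T}^n$ denote the set of $0$-mean, unit-length vectors $\mathbf{x} \in \mathbb{R}^n$ with $\rho(\mathbf{x},\mathbf{u}) = q$. Then: (1) $\mathcal{T}^n$ is an $(n-3)$-sphere embedded in $\mathbb{R}^n$. (2) If $\widehat{\mathbf{u}}$ is a random vector sampled uniformly from $\mathcal{T}^n$, then the expected sample correlation satisfies $\mathrm{E}[\rho(\widehat{\mathbf{u}},\mathbf{v})] = qr$.
   Context: A vector $\mathbf{x}=(x_1,\dots,x_n) \in \mathbb{R}^n$ is $0$-mean if $\sum_{i=1}^n x_i = 0$, and unit-length if $\|\mathbf{x}\|_2 = 1$. The Pearson product-moment correlation of two non-constant vectors $\mathbf{x},\mathbf{y}\in\mathbb{R}^n$ is $$\rho(\mathbf{x},\mathbf{y}) = \frac{(\mathbf{x}-\mu_{\mathbf{x}})^\top(\mathbf{y}-\mu_{\mathbf{y}})}{\|\mathbf{x}-\mu_{\mathbf{x}}\|_2\,\|\mathbf{y}-\mu_{\mathbf{y}}\|_2},$$ where $\mu_{\mathbf{x}}$ is the vector all of whose entries equal the mean of the entries of $\mathbf{x}$ (similarly $\mu_{\mathbf{y}}$). For $0$-mean unit-length vectors, $\rho(\mathbf{x},\mathbf{y})=\mathbf{x}^\top\mathbf{y}$. An $(n-3)$-sphere embedded in $\mathbb{R}^n$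 is the set of all points of some $(n-2)$-dimensional affine subspace $A \subset \mathbb{R}^n$ lying at a fixed distance $R\ge 0$ from a fixed point of $A$. The case $R=0$, a single point, is allowed as a degenerate sphere; it occurs when $|q|=1$. A $0$-sphere of positive radius consists of two points. "Sampled uniformly from $\mathcal{T}^n$" means sampled from the unique probability measure on this sphere that is invariant under the rotations and reflections (orthogonal transformations of $A$ about the center) preserving it. For $n=3$ and $|q|<1$ this is the uniform distribution on two points; for a single point it is the point mass. *)

theory Defs
  imports "HOL-Probability.Probability"
begin

definition zero_mean :: "real ^ 'n \<Rightarrow> bool" where
  "zero_mean x \<longleftrightarrow> (\<Sum>i\<in>UNIV. x $ i) = 0"

definition mean_vec :: "real ^ 'n \<Rightarrow> real ^ 'n" where
  "mean_vec x = (\<chi> i. (\<Sum>j\<in>UNIV. x $ j) / real CARD('n))"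

text \<open>Pearson correlation. It is meaningful for non-constant vectors; when one of the vectors
  is constant the denominator vanishes and the value is 0 by the division convention.\<close>

definition pearson :: "real ^ 'n \<Rightarrow> real ^ 'n \<Rightarrow> real" where
  "pearson x y =
     ((x - mean_vec x) \<bullet> (y - mean_vec y)) / (norm (x - mean_vec x) * norm (y - mean_vec y))"

definition corr_set :: "real ^ 'n \<Rightarrow> real \<Rightarrow> (real ^ 'n) set" where
  "corr_set u q = {x. zero_mean x \<and> norm x = 1 \<and> pearson x u = q}"

text \<open>A \<open>d\<close>-sphere lies in an affine subspace of dimension \<open>d + 1\<close>; radius 0 (a single point)
  is allowed. The dimension is an integer because \<^const>\<open>aff_dim\<close> is integer-valued.\<close>

definition is_sphere_in ::
  "int \<Rightarrow> 'a::euclidean_space set \<Rightarrow> 'a \<Rightarrow> real \<Rightarrow> 'a set \<Rightarrow> bool" where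
  "is_sphere_in d A c R S \<longleftrightarrow>
     affine A \<and> aff_dim A = d + 1 \<and> c \<in> A \<and> R \<ge> 0 \<and> S = A \<inter> sphere c R"

definition embedded_sphere :: "int \<Rightarrow> 'a::euclidean_space set \<Rightarrow> bool" where
  "embedded_sphere d S \<longleftrightarrow> (\<exists>A c R. is_sphere_in d A c R S)"

text \<open>The uniform distribution on a \<open>d\<close>-sphere \<open>S\<close>, as a Borel probability measure on the ambient
  space that is concentrated on \<open>S\<close>. Every orthogonal transformation of \<open>A\<close> about \<open>c\<close> is the
  restriction of a map \<open>x \<mapsto> c + f (x - c)\<close> that leaves \<open>A\<close> invariant, with \<open>f\<close> an orthogonal
  transformation of the ambient space. For \<open>d \<ge> 0\<close> and \<open>R > 0\<close> the triple \<open>(A, c, R)\<close> is determined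
  by \<open>S\<close>; for \<open>R = 0\<close> the choice of \<open>A\<close> is immaterial, as the point mass is the only candidate.\<close>

definition uniform_on_sphere :: "int \<Rightarrow> 'a::euclidean_space set \<Rightarrow> 'a measure \<Rightarrow> bool" where
  "uniform_on_sphere d S M \<longleftrightarrow>
     prob_space M \<and> sets M = sets borel \<and> emeasure M S = 1 \<and>
     (\<exists>A c R. is_sphere_in d A c R S \<and>
        (\<forall>f. orthogonal_transformation f \<and> (\<lambda>x. c + f (x - c)) ` A = A \<longrightarrow>
             distr M borel (\<lambda>x. c + f (x - c)) = M))"

end

theory Submission
  imports Defs
begin

text \<open>For zero-mean unit vectors the correlation is the inner product, so the set in question is
  the intersection of the unit sphere with the affine subspace of all \<open>x\<close> orthogonal to the all-ones
  vector with \<open>x \<bullet> u = q\<close>; by Pythagoras it is a sphere about \<open>q u\<close>. A uniform measure is invariant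
  under the point reflection in the centre, so its mean is the centre. The centre is unique, since the
  composition of two point reflections is a translation, and a nonempty bounded set is invariant
  under no nonzero translation. Hence the mean is \<open>q u\<close>, and the expected correlation with \<open>v\<close> is
  \<open>q u \<bullet> v = q r\<close>.\<close>

text \<open>The reflected point is the affine combination of \<open>c\<close> and \<open>x\<close>
  with weights 2 and -1, and reflecting in \<open>c\<close> preserves the distance to
  \<open>c\<close>.\<close>

lemma is_sphere_in_reflect:
  assumes "is_sphere_in d A c R S" "x \<in> S"
  shows "2 *\<^sub>R c - x \<in> S"
proof -
  have A: "affine A" "c \<in> A" "x \<in> A" and x: "dist c x = R" and S: "S = A \<inter> sphere c R"
    using assms by (auto simp: is_sphere_in_def)
  have "2 *\<^sub>R c + (-1) *\<^sub>R x \<in> A"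
    using A by (intro mem_affine) auto
  moreover have "dist c (2 *\<^sub>R c - x) = dist c x"
    by (simp add: dist_norm scaleR_2 norm_minus_commute)
  ultimately show ?thesis
    using x S by simp
qed

lemma is_sphere_in_center_unique:
  assumes S: "is_sphere_in d A c R S" and S': "is_sphere_in d' A' c' R' S" and "S \<noteq> {}"
  shows "c = c'"
proof -
  define w where "w = 2 *\<^sub>R (c - c')"
  \<comment> \<open>Reflecting first in \<open>c'\<close> and then in \<open>c\<close> translates by
    \<open>w\<close>.\<close>
  have shift: "x + w \<in> S" if "x \<in> S" for x
    using is_sphere_in_reflect[OF S is_sphere_in_reflect[OF S' that]]
    by (simp add: w_def algebra_simps)
  obtain x where x: "x \<in> S"
    using \<open>S \<noteq> {}\<close> by blast
  \<comment> \<open>Relative to \<open>c\<close>, the points \<open>x\<close>, \<open>x + w\<close>,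
    \<open>x + 2 w\<close> of \<open>S\<close> are \<open>y - w\<close>, \<open>y\<close>,
    \<open>y + w\<close>. Three equally spaced collinear points cannot lie on one sphere unless they
    coincide.\<close>
  define y where "y = x + w - c"
  have R: "norm (z - c) = R" if "z \<in> S" for z
    using S that by (auto simp: is_sphere_in_def dist_norm norm_minus_commute)
  have "norm (y - w) = R" "norm y = R" "norm (y + w) = R"
    using R[OF x] R[OF shift[OF x]] R[OF shift[OF shift[OF x]]]
    by (simp_all add: y_def algebra_simps)
  then have "(y - w) \<bullet> (y - w) = R\<^sup>2" "y \<bullet> y = R\<^sup>2" "(y + w) \<bullet> (y + w) = R\<^sup>2"
    by (simp_all flip: power2_norm_eq_inner)
  \<comment> \<open>The outer two equations minus twice the middle one leave
    \<open>2 (w \<bullet> w) = 0\<close>.\<close>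
  then have "w \<bullet> w = 0"
    by (simp add: inner_add inner_diff inner_commute)
  then show ?thesis
    by (simp add: w_def)
qed

text \<open>Invariance under \<open>f = -id\<close> gives \<open>m = 2 c - m\<close> for the mean
  \<open>m\<close>. Here \<open>c\<close> is the centre hidden in the existential of
  \<open>uniform_on_sphere\<close>.\<close>

lemma uniform_on_sphere_mean:
  fixes M :: "'a::euclidean_space measure"
  assumes "uniform_on_sphere d S M"
  obtains A c R where "is_sphere_in d A c R S" "integrable M (\<lambda>x. x)" "(\<integral>x. x \<partial>M) = c"
proof -
  from assms obtain A c R where "prob_space M" and sets: "sets M = sets borel"
    and S1: "emeasure M S = 1" and S: "is_sphere_in d A c R S"
    and inv: "\<And>f. orthogonal_transformation f \<Longrightarrow> (\<lambda>x. c + f (x - c)) ` A = A \<Longrightarrow>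
       distr M borel (\<lambda>x. c + f (x - c)) = M"
    unfolding uniform_on_sphere_def by blast
  interpret prob_space M by fact
  have [measurable_cong]: "sets M = sets borel" by fact
  \<comment> \<open>\<open>emeasure\<close> is 0 outside the sigma-algebra, so the value 1 forces
    measurability.\<close>
  have "S \<in> sets M"
    using S1 emeasure_notin_sets by fastforce
  then have AE_S: "AE x in M. x \<in> S"
    using S1 by (simp add: AE_in_set_eq_1 measure_def)
  have "S \<subseteq> sphere c R"
    using S by (auto simp: is_sphere_in_def)
  then obtain B where "\<And>x. x \<in> S \<Longrightarrow> norm x \<le> B"
    using bounded_sphere bounded_subset by (metis bounded_iff)
  then have int: "integrable M (\<lambda>x. x)"
    using AE_S by (intro integrable_const_bound[where B = B]) auto
  have A: "affine A" "c \<in> A"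
    using S by (auto simp: is_sphere_in_def)
  have refl: "2 *\<^sub>R c - x \<in> A" if "x \<in> A" for x
    using mem_affine[OF A that, of 2 "-1"] by simp
  have "(\<lambda>x. c + - (x - c)) ` A = A"
  proof
    show "(\<lambda>x. c + - (x - c)) ` A \<subseteq> A"
      using refl by (auto simp: scaleR_2 add_diff_eq)
    show "A \<subseteq> (\<lambda>x. c + - (x - c)) ` A"
    proof
      fix x assume "x \<in> A"
      then show "x \<in> (\<lambda>x. c + - (x - c)) ` A"
        by (intro image_eqI[where x = "2 *\<^sub>R c - x"] refl) (auto simp: scaleR_2)
    qed
  qed
  moreover have "orthogonal_transformation (\<lambda>x::'a. - x)"
    by (simp add: orthogonal_transformation_neg orthogonal_transformation_id)
  ultimately have "distr M borel (\<lambda>x. c + - (x - c)) = M"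
    using inv[of "\<lambda>x. - x"] by blast
  then have "(\<integral>x. x \<partial>M) = (\<integral>x. x \<partial>distr M borel (\<lambda>x. c + - (x - c)))"
    by simp
  also have "\<dots> = (\<integral>x. 2 *\<^sub>R c - x \<partial>M)"
    by (subst integral_distr) (simp_all add: scaleR_2 algebra_simps)
  also have "\<dots> = 2 *\<^sub>R c - (\<integral>x. x \<partial>M)"
    using int by (simp add: prob_space)
  finally have "2 *\<^sub>R (\<integral>x. x \<partial>M) = 2 *\<^sub>R c"
    by (simp add: scaleR_2 algebra_simps)
  then show ?thesis
    using that S int by simp
qed

lemma zero_mean_iff_inner: "zero_mean x \<longleftrightarrow> x \<bullet> 1 = 0"
  by (simp add: zero_mean_def inner_vec_def)

text \<open>In this form the mean visibly vanishes on zero-mean vectors and depends measurably on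
  \<open>x\<close>.\<close>

lemma mean_vec_eq_inner:
  fixes x :: "real ^ 'n"
  shows "mean_vec x = (x \<bullet> 1 / real CARD('n)) *\<^sub>R 1"
  by (simp add: mean_vec_def inner_vec_def vec_eq_iff)

lemma pearson_eq_inner:
  assumes "zero_mean x" "norm x = 1" "zero_mean y" "norm y = 1"
  shows "pearson x y = x \<bullet> y"
  using assms by (simp add: pearson_def mean_vec_eq_inner zero_mean_iff_inner)

lemma borel_measurable_pearson [measurable]: "(\<lambda>x. pearson x y) \<in> borel_measurable borel"
  unfolding pearson_def mean_vec_eq_inner by measurable

text \<open>The particular solution \<open>c\<close> makes the set a translate of the orthogonal
  complement of the span of \<open>a\<close> and \<open>b\<close>, which has codimension 2.\<close>

lemma aff_dim_two_orthogonal_hyperplanes: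
  fixes a b :: "'a::euclidean_space"
  assumes "a \<bullet> b = 0" "a \<noteq> 0" "b \<noteq> 0" "c \<bullet> a = \<alpha>" "c \<bullet> b = \<beta>"
  shows "aff_dim {x. x \<bullet> a = \<alpha> \<and> x \<bullet> b = \<beta>} = int DIM('a) - 2"
proof -
  let ?L = "{y. \<forall>x \<in> {a, b}. orthogonal x y}"
  have "a \<noteq> b"
    using assms by auto
  have "independent {a, b}"
    using assms by (intro pairwise_orthogonal_independent)
      (auto simp: pairwise_def orthogonal_def inner_commute)
  then have "dim {a, b} = 2"
    using \<open>a \<noteq> b\<close> by (simp add: dim_eq_card_independent)
  moreover have "dim {y \<in> UNIV. \<forall>x \<in> span {a, b}. orthogonal x y} + dim (span {a, b}) = dim (UNIV :: 'a set)"
    by (intro dim_subspace_orthogonal_to_vectors) auto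
  moreover have "?L = {y. \<forall>x \<in> span {a, b}. orthogonal x y}"
    by (metis (no_types, lifting) orthogonal_commute orthogonal_to_span span_base)
  ultimately have "int (dim ?L) = int DIM('a) - 2"
    by simp
  moreover have "aff_dim ?L = int (dim ?L)"
    by (intro aff_dim_subspace subspace_orthogonal_to_vectors)
  moreover have "{x. x \<bullet> a = \<alpha> \<and> x \<bullet> b = \<beta>} = (+) c ` ?L"
  proof (intro equalityI subsetI)
    fix x assume "x \<in> {x. x \<bullet> a = \<alpha> \<and> x \<bullet> b = \<beta>}"
    then show "x \<in> (+) c ` ?L"
      using assms by (intro image_eqI[where x = "x - c"])
        (auto simp: orthogonal_def inner_diff inner_commute)
  next
    fix x assume "x \<in> (+) c ` ?L"
    then show "x \<in> {x. x \<bullet> a = \<alpha> \<and> x \<bullet> b = \<beta>}"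
      using assms by (auto simp: orthogonal_def inner_add inner_commute)
  qed
  ultimately show ?thesis
    by (simp add: aff_dim_translation_eq)
qed

lemma corr_set_is_sphere_in:
  fixes u :: "real ^ 'n"
  assumes u: "zero_mean u" "norm u = 1" and q: "q \<in> {-1..1}"
  shows "is_sphere_in (int CARD('n) - 3) {x. x \<bullet> 1 = 0 \<and> x \<bullet> u = q} (q *\<^sub>R u)
    (sqrt (1 - q\<^sup>2)) (corr_set u q)"
proof -
  let ?A = "{x. x \<bullet> 1 = 0 \<and> x \<bullet> u = q}"
  have uu: "u \<bullet> u = 1" and u1: "u \<bullet> 1 = 0"
    using u by (simp_all add: zero_mean_iff_inner dot_square_norm)
  \<comment> \<open>\<open>sqrt\<close> is negative on negative arguments, so this bound is what
    makes the radius nonnegative.\<close>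
  have "q\<^sup>2 \<le> 1"
    using q by (simp add: abs_square_le_1 abs_le_iff)
  have "?A = {x. 1 \<bullet> x = 0} \<inter> {x. u \<bullet> x = q}"
    by (auto simp: inner_commute)
  then have "affine ?A"
    by (simp add: affine_hyperplane affine_Int)
  moreover have "aff_dim ?A = int CARD('n) - 3 + 1"
    using aff_dim_two_orthogonal_hyperplanes[of 1 u "q *\<^sub>R u" 0 q] uu u1
    by (cases "u = 0") (simp_all add: inner_commute)
  moreover have "corr_set u q = ?A \<inter> sphere (q *\<^sub>R u) (sqrt (1 - q\<^sup>2))"
  proof -
    have "norm x = 1 \<longleftrightarrow> dist (q *\<^sub>R u) x = sqrt (1 - q\<^sup>2)" if "x \<bullet> u = q" for x
    proof -
      have "dist (q *\<^sub>R u) x = sqrt (x \<bullet> x - q\<^sup>2)"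
        unfolding dist_norm norm_eq_sqrt_inner using that uu
        by (simp add: inner_diff inner_commute power2_eq_square)
      then show ?thesis
        by (simp add: norm_eq_1)
    qed
    moreover have "pearson x u = x \<bullet> u" if "zero_mean x" "norm x = 1" for x
      using that u by (intro pearson_eq_inner)
    ultimately show ?thesis
      by (auto simp: corr_set_def zero_mean_iff_inner)
  qed
  ultimately show ?thesis
    using uu u1 \<open>q\<^sup>2 \<le> 1\<close> by (simp add: is_sphere_in_def)
qed

theorem proposition1:
  fixes u v :: "real ^ 'n" and q r :: real
  assumes "CARD('n) \<ge> 3"
    and "zero_mean u" and "norm u = 1"
    and "zero_mean v" and "norm v = 1"
    and "pearson u v = r"
    and "q \<in> {-1..1}"
  shows "embedded_sphere (int CARD('n) - 3) (corr_set u q) \<and>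
    (\<forall>(P :: 'b measure) (uhat :: 'b \<Rightarrow> real ^ 'n).
       prob_space P \<and> uhat \<in> borel_measurable P \<and>
       uniform_on_sphere (int CARD('n) - 3) (corr_set u q) (distr P borel uhat) \<longrightarrow>
       integrable P (\<lambda>\<omega>. pearson (uhat \<omega>) v) \<and>
       prob_space.expectation P (\<lambda>\<omega>. pearson (uhat \<omega>) v) = q * r)"
proof (intro conjI allI impI; (elim conjE)?)
  let ?d = "int CARD('n) - 3" and ?S = "corr_set u q"
  note sphere = corr_set_is_sphere_in[OF assms(2,3,7)]
  then show "embedded_sphere ?d ?S"
    unfolding embedded_sphere_def by blast
  have r: "u \<bullet> v = r"
    using assms pearson_eq_inner by metis
  fix P :: "'b measure" and uhat :: "'b \<Rightarrow> real ^ 'n"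
  assume "prob_space P" and meas [measurable]: "uhat \<in> borel_measurable P"
    and unif: "uniform_on_sphere ?d ?S (distr P borel uhat)"
  interpret prob_space P by fact
  let ?M = "distr P borel uhat"
  have S1: "emeasure ?M ?S = 1"
    using unif by (simp add: uniform_on_sphere_def)
  then have "?S \<noteq> {}"
    by auto
  have S: "?S \<in> sets ?M"
    using S1 emeasure_notin_sets by fastforce
  interpret M: prob_space ?M
    by (rule prob_space_distr) simp
  have "AE x in ?M. x \<in> ?S"
    using S S1 by (simp add: M.AE_in_set_eq_1 measure_def)
  \<comment> \<open>The correlation agrees with a linear function of \<open>x\<close> on
    \<open>?S\<close>, so almost everywhere, which suffices for the expectation.\<close>
  then have "AE x in ?M. x \<bullet> v = pearson x v"
    by eventually_elim (use assms(4,5) in \<open>simp add: corr_set_def pearson_eq_inner\<close>)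
  then have ae: "AE \<omega> in P. uhat \<omega> \<bullet> v = pearson (uhat \<omega>) v"
    by (simp add: AE_distr_iff)
  obtain A c R where "is_sphere_in ?d A c R ?S"
    and int: "integrable ?M (\<lambda>x. x)" and c: "(\<integral>x. x \<partial>?M) = c"
    using uniform_on_sphere_mean[OF unif] by blast
  \<comment> \<open>The centre supplied by uniformity need not be the computed one a priori;
    uniqueness of the centre identifies them, even at radius 0.\<close>
  then have c_eq: "c = q *\<^sub>R u"
    using is_sphere_in_center_unique sphere \<open>?S \<noteq> {}\<close> by blast
  have int': "integrable P uhat"
    using int by (simp add: integrable_distr_eq)
  have "integrable P (\<lambda>\<omega>. uhat \<omega> \<bullet> v)"
    using int' by simp
  then show "integrable P (\<lambda>\<omega>. pearson (uhat \<omega>) v)"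
    using ae by (subst (asm) integrable_cong_AE) simp_all
  have "expectation (\<lambda>\<omega>. pearson (uhat \<omega>) v) = expectation (\<lambda>\<omega>. uhat \<omega> \<bullet> v)"
    using ae by (intro integral_cong_AE) (auto simp: eq_commute)
  also have "\<dots> = expectation uhat \<bullet> v"
    using int' by simp
  also have "expectation uhat = c"
    using c by (simp add: integral_distr)
  finally show "expectation (\<lambda>\<omega>. pearson (uhat \<omega>) v) = q * r"
    by (simp add: c_eq r)
qed

end
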